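(* Let either $p\in(1,\infty]$, $q\in[1,\infty]$, $\alpha\in\mathbb{R}$, or $p=1$, $q\in[1,\infty]$, $\alpha<-\frac1q$. Then $\ell^{(p,q;\alpha)}$ (with the functional $\|\cdot\|_{(p,q;\alpha)}$) is a rearrangement-invariant Banach sequence space.
   Context: $\mathcal{M}$ is the set of all sequences $a=\{a_n\}_{n=1}^\infty$ with values in $[-\infty,\infty]$; $m$ is the counting measure on $\mathbb{N}=\{1,2,\dots\}$. For $a\in\mathcal{M}$ the distribution function is $a_*(\lambda)=m(\{k:|a_k|>\lambda\})$, $\lambda\ge0$, the non-increasing rearrangement is $a_n^*=\inf\{\lambda\in[0,\infty): a_*(\lambda)\le n-1\}$ ($\inf\emptyset=\infty$), and the maximal sequence is $a_n^{**}=\frac1n\sum_{k=1}^n a_k^*$. Conventions: $1/\infty=0$, $0\cdot\infty=0$. $\|a\|_q=(\sum_n|a_n|^q)^{1/q}$ for $0<q<\infty$ and $\|a\|_\infty=\sup_n|a_n|$. $\|a\|_{(p,q;\alpha)}=\big\|\{a_n^{**}\,n^{\frac1p-\frac1q}(1+\log n)^\alpha\}_n\big\|_q$ and $\ell^{(p,q;\alpha)}=\{a\in\mathcal{M}:\|a\|_{(p,q;\alpha)}<\infty\}$. For a functional $\|\cdot\|_X:\mathcal{M}\to[0,\infty]$, the space $X=\{a\in\mathcal{M}:\|a\|_X<\infty\}$ is a Banach sequence space if: (P1) $\|\cdot\|_X$ is a norm (i.e. $\|a\|_X=0$ iff $a=0$, $\|ca\|_X=|c|\|a\|_X$ for $c\in\mathbb{R}$,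 $\|a+b\|_X\le\|a\|_X+\|b\|_X$ whenever $a+b$ is defined) and $\|a\|_X=\||a|\|_X$ for all $a\in\mathcal{M}$; (P2) $0\le a\le b$ (pointwise) implies $\|a\|_X\le\|b\|_X$; (P3) if $0\le a^n\nearrow a$ pointwise, then $\|a^n\|_X\nearrow\|a\|_X$; (P4) $\|\chi_E\|_X<\infty$ whenever $E\subset\mathbb{N}$, $m(E)<\infty$ ($\chi_E$ being the characteristic sequence of $E$); (P5) if $m(E)<\infty$, there is a constant $C_E$ such that $\sum_{n\in E}|a_n|\le C_E\|a\|_X$ for all $a\in X$. It is rearrangement-invariant if $\|a\|_X=\|b\|_X$ whenever $a,b\in\mathcal{M}$ and $a_*=b_*$. *)

theory Defs
  imports "HOL-Analysis.Analysis"
begin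

text \<open>
  Sequences indexed by \<open>{1, 2, \<dots>}\<close> with values in the extended reals are rendered as functions
  \<open>nat \<Rightarrow> ereal\<close> with the index shifted by one: \<open>a n\<close> is the term with index \<open>Suc n\<close>, so that the
  set of all sequences is exactly the whole type. Functionals with values in the closed interval
  from 0 to infinity are \<open>ennreal\<close>-valued.
\<close>

definition distr_fun :: "(nat \<Rightarrow> ereal) \<Rightarrow> real \<Rightarrow> ennreal" where
  "distr_fun a t = emeasure (count_space UNIV) {k. \<bar>a k\<bar> > ereal t}"

text \<open>
  With the index shift, the bound on the distribution function for the term with index
  \<open>Suc n\<close> is \<open>Suc n - 1 = n\<close>. The infimum of the empty set is \<open>\<infinity>\<close>.
\<close>

definition rearr :: "(nat \<Rightarrow> ereal) \<Rightarrow> nat \<Rightarrow> ereal" where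
  "rearr a n = Inf {ereal t | t. 0 \<le> t \<and> distr_fun a t \<le> of_nat n}"

definition maximal_seq :: "(nat \<Rightarrow> ereal) \<Rightarrow> nat \<Rightarrow> ereal" where
  "maximal_seq a n = (\<Sum>k\<le>n. rearr a k) / ereal (real (Suc n))"

text \<open>Powers with a positive real exponent; the exponent is never \<open>\<le> 0\<close> in what follows.\<close>

definition ennreal_powr :: "ennreal \<Rightarrow> real \<Rightarrow> ennreal" where
  "ennreal_powr x r = (if x = \<infinity> then \<infinity> else ennreal (enn2real x powr r))"

definition lq_norm :: "ennreal \<Rightarrow> (nat \<Rightarrow> ereal) \<Rightarrow> ennreal" where
  "lq_norm q a =
    (if q = \<infinity> then (SUP n. e2ennreal \<bar>a n\<bar>)
     else ennreal_powr (\<Sum>n. ennreal_powr (e2ennreal \<bar>a n\<bar>) (enn2real q)) (1 / enn2real q))"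

text \<open>The exponents \<open>p\<close> and \<open>q\<close> may be \<open>\<infinity>\<close>; in \<open>ennreal\<close> one has \<open>1 / \<infinity> = 0\<close>.\<close>

definition lz_norm :: "ennreal \<Rightarrow> ennreal \<Rightarrow> real \<Rightarrow> (nat \<Rightarrow> ereal) \<Rightarrow> ennreal" where
  "lz_norm p q \<alpha> a =
    lq_norm q (\<lambda>n. maximal_seq a n *
      ereal (real (Suc n) powr (enn2real (1 / p) - enn2real (1 / q))
             * (1 + ln (real (Suc n))) powr \<alpha>))"

definition lz_space :: "ennreal \<Rightarrow> ennreal \<Rightarrow> real \<Rightarrow> (nat \<Rightarrow> ereal) set" where
  "lz_space p q \<alpha> = {a. lz_norm p q \<alpha> a < \<infinity>}"

text \<open>
  Since \<open>ereal\<close> addition is total, the triangle inequality is restricted to those \<open>a\<close> and \<open>b\<close>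
  for which \<open>\<infinity> - \<infinity>\<close> does not occur in any term of the sum.
\<close>

locale banach_sequence_space =
  fixes X :: "(nat \<Rightarrow> ereal) set" and N :: "(nat \<Rightarrow> ereal) \<Rightarrow> ennreal"
  assumes space_eq: "X = {a. N a < \<infinity>}"
    and P1_zero: "N a = 0 \<longleftrightarrow> (\<forall>n. a n = 0)"
    and P1_scale: "N (\<lambda>n. ereal c * a n) = ennreal \<bar>c\<bar> * N a"
    and P1_triangle:
      "(\<And>n. \<not> (a n = \<infinity> \<and> b n = -\<infinity>) \<and> \<not> (a n = -\<infinity> \<and> b n = \<infinity>)) \<Longrightarrow>
        N (\<lambda>n. a n + b n) \<le> N a + N b"
    and P1_abs: "N (\<lambda>n. \<bar>a n\<bar>) = N a"
    and P2: "(\<And>n. 0 \<le> a n \<and> a n \<le> b n) \<Longrightarrow> N a \<le> N b"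
    and P3:
      "(\<And>k n. 0 \<le> f k n) \<Longrightarrow> (\<And>n. incseq (\<lambda>k. f k n)) \<Longrightarrow>
        (\<And>n. (\<lambda>k. f k n) \<longlonglongrightarrow> a n) \<Longrightarrow>
        incseq (\<lambda>k. N (f k)) \<and> (\<lambda>k. N (f k)) \<longlonglongrightarrow> N a"
    and P4: "finite E \<Longrightarrow> N (indicator E) < \<infinity>"
    and P5:
      "finite E \<Longrightarrow>
        \<exists>C :: real. \<forall>a\<in>X. (\<Sum>n\<in>E. e2ennreal \<bar>a n\<bar>) \<le> ennreal C * N a"

locale ri_banach_sequence_space = banach_sequence_space +
  assumes rearrangement_invariant:
    "(\<And>t. 0 \<le> t \<Longrightarrow> distr_fun a t = distr_fun b t) \<Longrightarrow> N a = N b"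

end

theory Submission
  imports Defs "HOL-Real_Asymp.Real_Asymp"
begin

text \<open>
  The partial sum of the first \<open>n\<close> terms of the rearrangement of \<open>a\<close> is the supremum of the sums of
  \<open>\<bar>a k\<bar>\<close> over all index sets with at most \<open>n\<close> elements. This supremum is monotone, homogeneous,
  subadditive and continuous along increasing sequences, and the norm is a weighted \<open>l\<^sup>q\<close> norm of it,
  so (P1), (P2), (P3) are inherited from Minkowski's inequality and monotone convergence, and (P5)
  holds because a single term of the weighted sequence already dominates the sum over \<open>E\<close>. (P4)
  amounts to the finiteness of the \<open>l\<^sup>q\<close> norm of the weight, which is where the conditions on
  \<open>p\<close>, \<open>q\<close>, \<open>\<alpha>\<close> enter.
\<close>

section \<open>Largest sums over at most \<open>n\<close> indices\<close>

definition topsum :: "('i \<Rightarrow> ennreal) \<Rightarrow> nat \<Rightarrow> ennreal" where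
  "topsum f n = (SUP E\<in>{E. finite E \<and> card E \<le> n}. \<Sum>k\<in>E. f k)"

lemma topsum_upper: "finite E \<Longrightarrow> card E \<le> n \<Longrightarrow> (\<Sum>k\<in>E. f k) \<le> topsum f n"
  unfolding topsum_def by (rule SUP_upper) simp

lemma topsum_least:
  "(\<And>E. finite E \<Longrightarrow> card E \<le> n \<Longrightarrow> (\<Sum>k\<in>E. f k) \<le> c) \<Longrightarrow> topsum f n \<le> c"
  unfolding topsum_def by (rule SUP_least) simp

lemma topsum_mono: "(\<And>k. f k \<le> g k) \<Longrightarrow> topsum f n \<le> topsum g n"
  by (rule topsum_least) (rule order_trans[OF sum_mono topsum_upper])

lemma topsum_add: "topsum (\<lambda>k. f k + g k) n \<le> topsum f n + topsum g n"
  by (rule topsum_least) (auto simp: sum.distrib intro!: add_mono topsum_upper)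

lemma topsum_cmult: "topsum (\<lambda>k. c * f k) n = c * topsum f n"
  unfolding topsum_def by (simp add: SUP_mult_left_ennreal sum_distrib_left)

text \<open>Finite sums commute with increasing suprema, and the supremum over index sets then
  trades places with the one over \<open>j\<close>.\<close>

lemma topsum_SUP:
  assumes "\<And>k. incseq (\<lambda>j. f j k)"
  shows "topsum (\<lambda>k. SUP j. f j k) n = (SUP j::nat. topsum (f j) n)"
proof -
  have "(\<Sum>k\<in>E. SUP j. f j k) = (SUP j. \<Sum>k\<in>E. f j k)" for E
    by (rule ennreal_SUP_sum [symmetric]) (rule assms)
  then show ?thesis unfolding topsum_def by simp (rule SUP_commute)
qed

section \<open>The rearrangement and its partial sums\<close>

lemma rearr_nonneg: "0 \<le> rearr a n"
  unfolding rearr_def by (rule Inf_greatest) auto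

text \<open>If all indices with \<open>\<bar>a k\<bar>\<close> above \<open>y\<close> lay in
  \<open>E\<close>, there would be at most \<open>n\<close> of them, and \<open>y\<close> would
  compete in the infimum that defines \<open>rearr a n\<close>.\<close>

lemma less_rearrD:
  assumes "0 \<le> y" "ereal y < rearr a n" "finite E" "card E \<le> n"
  obtains e where "e \<notin> E" "ereal y < \<bar>a e\<bar>"
proof -
  have "\<not> distr_fun a y \<le> of_nat n"
  proof
    assume "distr_fun a y \<le> of_nat n"
    then have "rearr a n \<le> ereal y"
      unfolding rearr_def using assms(1) by (intro Inf_lower) blast
    with assms(2) show False by simp
  qed
  moreover have "distr_fun a y \<le> of_nat n" if "{k. \<bar>a k\<bar> > ereal y} \<subseteq> E"
    using that assms(4) finite_subset[OF that assms(3)] card_mono[OF assms(3) that]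
    unfolding distr_fun_def by (simp add: emeasure_count_space)
  ultimately show ?thesis using that by blast
qed

text \<open>A level \<open>t\<close> below \<open>x\<close> is exceeded on all of \<open>E\<close>,
  hence at more than \<open>n\<close> indices, so it does not compete in the infimum.\<close>

lemma rearr_ge:
  assumes "finite E" "n < card E" "\<And>e. e \<in> E \<Longrightarrow> x \<le> \<bar>a e\<bar>"
  shows "x \<le> rearr a n"
  unfolding rearr_def
proof (rule Inf_greatest, safe)
  fix t :: real assume t: "0 \<le> t" "distr_fun a t \<le> of_nat n"
  show "x \<le> ereal t"
  proof (rule ccontr)
    assume "\<not> x \<le> ereal t"
    then have "E \<subseteq> {k. \<bar>a k\<bar> > ereal t}" using assms(3) by force
    then have "of_nat (card E) \<le> distr_fun a t"
      unfolding distr_fun_def using assms(1) emeasure_mono[of E "{k. \<bar>a k\<bar> > ereal t}" "count_space UNIV"]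
      by (simp add: emeasure_count_space)
    from order_trans[OF this t(2)] assms(2) show False by simp
  qed
qed

text \<open>The induction removes an index of smallest value. The smallest of \<open>Suc n\<close>
  values is at most \<open>rearr a n\<close> by \<open>rearr_ge\<close>, and the remaining
  \<open>n\<close> values fall under the induction hypothesis.\<close>

lemma sum_le_sum_rearr:
  assumes "finite E" "card E \<le> n"
  shows "(\<Sum>k\<in>E. e2ennreal \<bar>a k\<bar>) \<le> (\<Sum>k<n. e2ennreal (rearr a k))"
  using assms
proof (induction n arbitrary: E)
  case 0
  then show ?case by simp
next
  case (Suc n)
  show ?case
  proof (cases "card E \<le> n")
    case True
    with Suc have "(\<Sum>k\<in>E. e2ennreal \<bar>a k\<bar>) \<le> (\<Sum>k<n. e2ennreal (rearr a k))" by blast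
    then show ?thesis by (simp add: add_increasing2)
  next
    case False
    with Suc.prems have card: "card E = Suc n" by simp
    then have "E \<noteq> {}" by auto
    then obtain e where e: "e \<in> E" "\<And>k. k \<in> E \<Longrightarrow> \<bar>a e\<bar> \<le> \<bar>a k\<bar>"
      using arg_min_if_finite[OF Suc.prems(1), of "\<lambda>k. \<bar>a k\<bar>"] by (metis linorder_not_less)
    have "(\<Sum>k\<in>E - {e}. e2ennreal \<bar>a k\<bar>) \<le> (\<Sum>k<n. e2ennreal (rearr a k))"
      using Suc.IH[of "E - {e}"] Suc.prems e card by simp
    moreover have "\<bar>a e\<bar> \<le> rearr a n"
      by (rule rearr_ge[OF Suc.prems(1)]) (use e card in auto)
    ultimately show ?thesis
      using sum.remove[OF Suc.prems(1) e(1), of "\<lambda>k. e2ennreal \<bar>a k\<bar>"]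
      by (simp add: add.commute add_mono e2ennreal_mono)
  qed
qed

text \<open>Only values below \<open>rearr a n\<close> are compared with a further term \<open>a e\<close>: the suprema need not
  be attained, as for a strictly increasing bounded sequence.\<close>

lemma rearr_add_topsum_le:
  "e2ennreal (rearr a n) + topsum (\<lambda>k. e2ennreal \<bar>a k\<bar>) n \<le> topsum (\<lambda>k. e2ennreal \<bar>a k\<bar>) (Suc n)"
    (is "?r + topsum ?f n \<le> _")
proof -
  have "?r + (\<Sum>k\<in>E. ?f k) \<le> topsum ?f (Suc n)" if E: "finite E" "card E \<le> n" for E
  proof (cases "?r = 0")
    case True
    then show ?thesis using topsum_upper[of E "Suc n" ?f] E by simp
  next
    case False
    \<comment> \<open>Approximation of \<open>?r\<close> from below needs \<open>?r\<close> to be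
      nonzero: otherwise the supremum would range over the empty set and lose the sum over
      \<open>E\<close>.\<close>
    have "?r + (\<Sum>k\<in>E. ?f k) = (SUP y\<in>{..<?r}. y + (\<Sum>k\<in>E. ?f k))"
    proof (subst ennreal_SUP_add_left)
      show "{..<?r} \<noteq> {}" using False by (metis empty_iff lessThan_iff not_gr_zero)
    qed simp
    also have "\<dots> \<le> topsum ?f (Suc n)"
    proof (rule SUP_least)
      fix y assume "y \<in> {..<?r}"
      then have y: "y < ?r" by simp
      then obtain t where t: "0 \<le> t" "y = ennreal t"
        by (cases y) auto
      then have "ereal t < rearr a n"
        using y rearr_nonneg[of a n]
        by (metis e2ennreal_ereal e2ennreal_mono linorder_not_less)
      then obtain e where e: "e \<notin> E" "ereal t < \<bar>a e\<bar>"
        using less_rearrD[OF t(1) _ E] by blast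
      have "y \<le> ?f e" using t e(2) e2ennreal_mono[of "ereal t" "\<bar>a e\<bar>"] by simp
      then have "y + (\<Sum>k\<in>E. ?f k) \<le> (\<Sum>k\<in>insert e E. ?f k)"
        using E e by (simp add: add_right_mono)
      also have "\<dots> \<le> topsum ?f (Suc n)" using E e by (intro topsum_upper) auto
      finally show "y + (\<Sum>k\<in>E. ?f k) \<le> topsum ?f (Suc n)" .
    qed
    finally show ?thesis .
  qed
  moreover have "{E :: nat set. finite E \<and> card E \<le> n} \<noteq> {}"
    by (auto intro: exI[of _ "{}"])
  then have "?r + topsum ?f n = (SUP E\<in>{E. finite E \<and> card E \<le> n}. ?r + (\<Sum>k\<in>E. ?f k))"
    unfolding topsum_def by (rule ennreal_SUP_add_right)
  ultimately show ?thesis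
    by (simp add: SUP_le_iff)
qed

lemma sum_rearr_eq_topsum:
  "(\<Sum>k<n. e2ennreal (rearr a k)) = topsum (\<lambda>k. e2ennreal \<bar>a k\<bar>) n"
proof (rule antisym)
  show "topsum (\<lambda>k. e2ennreal \<bar>a k\<bar>) n \<le> (\<Sum>k<n. e2ennreal (rearr a k))"
    by (rule topsum_least) (rule sum_le_sum_rearr)
  show "(\<Sum>k<n. e2ennreal (rearr a k)) \<le> topsum (\<lambda>k. e2ennreal \<bar>a k\<bar>) n"
  proof (induction n)
    case (Suc n)
    then show ?case
      using order_trans[OF add_left_mono[OF Suc] rearr_add_topsum_le[of a n]]
      by (simp add: add.commute)
  qed simp
qed

section \<open>Powers and \<open>l^q\<close> norms with values in [0, infinity]\<close>

lemma ennreal_powr_le_iff: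
  assumes "r > 0"
  shows "ennreal_powr x r \<le> y \<longleftrightarrow> x \<le> ennreal_powr y (1 / r)"
proof -
  have "s powr r \<le> t \<longleftrightarrow> s \<le> t powr (1 / r)" if "0 \<le> s" "0 \<le> t" for s t :: real
    using that assms powr_mono2[of "1 / r" "s powr r" t] powr_mono2[of r s "t powr (1 / r)"]
    by (auto simp: powr_powr)
  then show ?thesis
    by (cases x; cases y) (auto simp: ennreal_powr_def top_unique)
qed

lemma ennreal_powr_powr_inverse:
  "r > 0 \<Longrightarrow> ennreal_powr (ennreal_powr x r) (1 / r) = x"
  by (cases x) (auto simp: ennreal_powr_def powr_powr)

lemma ennreal_powr_inverse_powr:
  "r > 0 \<Longrightarrow> ennreal_powr (ennreal_powr x (1 / r)) r = x"
  by (cases x) (auto simp: ennreal_powr_def powr_powr)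

lemma ennreal_powr_mono: "r > 0 \<Longrightarrow> x \<le> y \<Longrightarrow> ennreal_powr x r \<le> ennreal_powr y r"
  by (simp add: ennreal_powr_le_iff ennreal_powr_powr_inverse)

lemma ennreal_powr_less_top_iff: "ennreal_powr x r < \<infinity> \<longleftrightarrow> x < \<infinity>"
  by (auto simp: ennreal_powr_def less_top)

lemma ennreal_powr_ennreal: "0 \<le> x \<Longrightarrow> ennreal_powr (ennreal x) r = ennreal (x powr r)"
  by (simp add: ennreal_powr_def)

lemma ennreal_powr_mult:
  assumes "r > 0"
  shows "ennreal_powr (x * y) r = ennreal_powr x r * ennreal_powr y r"
proof (cases x; cases y)
  fix s t :: real assume "x = ennreal s" "0 \<le> s" "y = ennreal t" "0 \<le> t"
  then show ?thesis
    by (simp add: ennreal_powr_ennreal powr_mult flip: ennreal_mult)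
qed (use assms in \<open>auto simp: ennreal_powr_def ennreal_mult_top ennreal_top_mult ennreal_eq_0_iff\<close>)

text \<open>By \<open>ennreal_powr_le_iff\<close> the powers with exponents \<open>r\<close> and
  \<open>1 / r\<close> form a Galois connection, and a lower adjoint preserves all suprema, the
  empty one included.\<close>

lemma ennreal_powr_SUP:
  assumes "r > 0"
  shows "ennreal_powr (SUP i\<in>I. f i) r = (SUP i\<in>I. ennreal_powr (f i) r)"
proof (rule antisym)
  show "ennreal_powr (SUP i\<in>I. f i) r \<le> (SUP i\<in>I. ennreal_powr (f i) r)"
    unfolding ennreal_powr_le_iff[OF assms]
    by (rule SUP_least) (subst ennreal_powr_le_iff[OF assms, symmetric], rule SUP_upper)
  show "(SUP i\<in>I. ennreal_powr (f i) r) \<le> ennreal_powr (SUP i\<in>I. f i) r"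
    by (intro SUP_least ennreal_powr_mono assms SUP_upper)
qed

text \<open>This is \<open>lq_norm\<close> moved to \<open>ennreal\<close>-valued sequences, so that
  absolute values and conversions from \<open>ereal\<close> are dealt with once, in
  \<open>lz_norm_eq\<close>.\<close>

definition ell_norm :: "ennreal \<Rightarrow> (nat \<Rightarrow> ennreal) \<Rightarrow> ennreal" where
  "ell_norm q f =
    (if q = \<infinity> then (SUP n. f n)
     else ennreal_powr (\<Sum>n. ennreal_powr (f n) (enn2real q)) (1 / enn2real q))"

lemma ennreal_ge_1_cases:
  assumes "1 \<le> (q :: ennreal)"
  obtains "q = \<infinity>" | "q \<noteq> \<infinity>" "1 \<le> enn2real q"
  using assms by (cases q) (auto simp flip: ennreal_1)

lemma ell_norm_mono:
  assumes "1 \<le> q" "\<And>n. f n \<le> g n"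
  shows "ell_norm q f \<le> ell_norm q g"
  using assms(1)
proof (cases rule: ennreal_ge_1_cases)
  case 1
  then show ?thesis using assms(2) by (auto simp: ell_norm_def intro!: SUP_mono)
next
  case 2
  then show ?thesis using assms(2)
    by (auto simp: ell_norm_def intro!: ennreal_powr_mono suminf_le)
qed

lemma le_ell_norm:
  assumes "1 \<le> q"
  shows "f n \<le> ell_norm q f"
  using assms
proof (cases rule: ennreal_ge_1_cases)
  case 1
  then show ?thesis by (auto simp: ell_norm_def intro!: SUP_upper)
next
  case 2
  have "ennreal_powr (f n) (enn2real q) \<le> (\<Sum>n. ennreal_powr (f n) (enn2real q))"
    using sum_le_suminf[of "\<lambda>n. ennreal_powr (f n) (enn2real q)" "{n}"] by simp
  with 2 show ?thesis by (simp add: ell_norm_def ennreal_powr_le_iff)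
qed

lemma ell_norm_0: "1 \<le> q \<Longrightarrow> ell_norm q (\<lambda>n. 0) = 0"
  by (erule ennreal_ge_1_cases) (auto simp: ell_norm_def ennreal_powr_def)

lemma ell_norm_cmult:
  assumes "1 \<le> q"
  shows "ell_norm q (\<lambda>n. c * f n) = c * ell_norm q f"
  using assms
proof (cases rule: ennreal_ge_1_cases)
  case 1
  then show ?thesis by (simp add: ell_norm_def SUP_mult_left_ennreal)
next
  case 2
  then show ?thesis by (simp add: ell_norm_def ennreal_powr_mult ennreal_powr_powr_inverse)
qed

text \<open>For finite \<open>q\<close> this is monotone convergence for series, with the suprema
  passing through both powers by \<open>ennreal_powr_SUP\<close>. For infinite \<open>q\<close> two
  suprema are interchanged.\<close>

lemma ell_norm_SUP:
  assumes "1 \<le> q" "\<And>n. incseq (\<lambda>j. f j n)"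
  shows "ell_norm q (\<lambda>n. SUP j. f j n) = (SUP j::nat. ell_norm q (f j))"
  using assms(1)
proof (cases rule: ennreal_ge_1_cases)
  case 1
  then show ?thesis by (simp add: ell_norm_def) (rule SUP_commute)
next
  case 2
  then have "incseq (\<lambda>j. ennreal_powr (f j n) (enn2real q))" for n
    using assms(2) unfolding incseq_def by (intro allI impI ennreal_powr_mono) auto
  with 2 show ?thesis
    by (simp add: ell_norm_def ennreal_powr_SUP ennreal_suminf_SUP_eq)
qed

text \<open>Convexity of \<open>t \<mapsto> t powr r\<close> at the point \<open>(x + y) / (A + B)\<close>, a convex combination of
  \<open>x / A\<close> and \<open>y / B\<close>.\<close>

lemma powr_add_le:
  fixes r A B x y :: real
  assumes "1 \<le> r" "0 < A" "0 < B" "0 \<le> x" "0 \<le> y"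
  shows "(x + y) powr r \<le>
    (A + B) powr r * (A / (A + B) / A powr r * x powr r + B / (A + B) / B powr r * y powr r)"
proof -
  have conv: "((1 - t) * u + t * v) powr r \<le> (1 - t) * u powr r + t * v powr r"
    if "0 \<le> t" "t \<le> 1" "0 \<le> u" "0 \<le> v" for t u v :: real
  proof (cases "u = 0 \<or> v = 0")
    case True
    \<comment> \<open>With one of the two points at 0, convexity reduces to this bound for the
      coefficient \<open>t\<close> or \<open>1 - t\<close> of the other point.\<close>
    have "s powr r \<le> s" if "0 \<le> s" "s \<le> 1" for s :: real
      using powr_mono'[of 1 r s] that assms(1) by (cases "s = 0") auto
    then show ?thesis
      using True that assms(1) by (auto simp: powr_mult intro!: mult_right_mono)
  next
    case False
    then show ?thesis
      using convex_onD[OF powr_convex[OF assms(1)], of t u v] that by simp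
  qed
  have weight: "1 - B / (A + B) = A / (A + B)"
    using assms by (simp add: field_simps)
  then have eq: "x + y = (A + B) * ((1 - B / (A + B)) * (x / A) + B / (A + B) * (y / B))"
    using assms by (simp add: distrib_left)
  have "(x + y) powr r =
      (A + B) powr r * ((1 - B / (A + B)) * (x / A) + B / (A + B) * (y / B)) powr r"
    using assms by (subst eq, subst powr_mult) (auto intro!: add_nonneg_nonneg mult_nonneg_nonneg)
  also have "\<dots> \<le> (A + B) powr r * ((1 - B / (A + B)) * (x / A) powr r + B / (A + B) * (y / B) powr r)"
    using assms by (intro mult_left_mono conv) auto
  finally show ?thesis
    using assms by (simp add: weight powr_divide)
qed

text \<open>For finite \<open>q\<close>, normalising \<open>f\<close> and \<open>g\<close> by their
  norms \<open>A\<close> and \<open>B\<close> makes convexity of the power applicable term by term.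
  After summation the two parts contribute \<open>A / (A + B)\<close> and
  \<open>B / (A + B)\<close>, which add up to 1. Norms that are 0 or infinite cannot be divided by
  and are treated separately.\<close>

lemma ell_norm_add:
  assumes "1 \<le> q"
  shows "ell_norm q (\<lambda>n. f n + g n) \<le> ell_norm q f + ell_norm q g"
  using assms
proof (cases rule: ennreal_ge_1_cases)
  case 1
  then show ?thesis by (auto simp: ell_norm_def intro!: SUP_least add_mono SUP_upper)
next
  case 2
  define r where "r = enn2real q"
  have r: "1 \<le> r" "0 < r" using 2 by (auto simp: r_def)
  have norm: "ell_norm q h = ennreal_powr (\<Sum>n. ennreal_powr (h n) r) (1 / r)" for h
    using 2 by (simp add: ell_norm_def r_def)
  consider "ell_norm q f = \<infinity> \<or> ell_norm q g = \<infinity>" | "ell_norm q f = 0 \<or> ell_norm q g = 0"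
    | A B where "ell_norm q f = ennreal A" "0 < A" "ell_norm q g = ennreal B" "0 < B"
    by (cases "ell_norm q f"; cases "ell_norm q g") (fastforce simp: less_le)+
  then show ?thesis
  proof cases
    case 1
    then show ?thesis by auto
  next
    case 2
    have zero: "h n = 0" if "ell_norm q h = 0" for h n
      using le_ell_norm[OF assms, of h n] that by simp
    show ?thesis
    proof (cases "ell_norm q f = 0")
      case True
      then show ?thesis using zero[of f] by simp
    next
      case False
      then have "ell_norm q g = 0" using 2 by simp
      then show ?thesis using zero[of g] by simp
    qed
  next
    case 3
    have fin: "f n < \<infinity>" "g n < \<infinity>" for n
      using le_ell_norm[OF assms, of f n] le_ell_norm[OF assms, of g n] 3
      by (auto intro: le_less_trans)
    have sums: "(\<Sum>n. ennreal_powr (f n) r) = ennreal (A powr r)"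
      "(\<Sum>n. ennreal_powr (g n) r) = ennreal (B powr r)"
      using 3 ennreal_powr_inverse_powr[OF r(2), of "\<Sum>n. ennreal_powr (f n) r"]
        ennreal_powr_inverse_powr[OF r(2), of "\<Sum>n. ennreal_powr (g n) r"]
      unfolding norm by (simp_all add: ennreal_powr_ennreal)
    \<comment> \<open>These are the coefficients in \<open>powr_add_le\<close>; multiplied by the
      sums \<open>A powr r\<close> and \<open>B powr r\<close> they leave the convex
      weights.\<close>
    define C D where "C = A / (A + B) / A powr r" and "D = B / (A + B) / B powr r"
    have CD: "0 \<le> C" "0 \<le> D" using 3 by (auto simp: C_def D_def)
    have le: "ennreal_powr (f n + g n) r \<le> ennreal ((A + B) powr r) *
        (ennreal C * ennreal_powr (f n) r + ennreal D * ennreal_powr (g n) r)" for n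
    proof -
      obtain x y where xy: "f n = ennreal x" "0 \<le> x" "g n = ennreal y" "0 \<le> y"
        using fin[of n] by (cases "f n"; cases "g n") auto
      have "(x + y) powr r \<le> (A + B) powr r * (C * x powr r + D * y powr r)"
        unfolding C_def D_def using powr_add_le r(1) 3 xy by blast
      then show ?thesis
        using xy CD
        by (simp add: ennreal_powr_ennreal ennreal_leI flip: ennreal_plus ennreal_mult)
    qed
    have "(\<Sum>n. ennreal_powr (f n + g n) r) \<le> ennreal ((A + B) powr r) *
        (ennreal C * ennreal (A powr r) + ennreal D * ennreal (B powr r))"
      using suminf_le[of "\<lambda>n. ennreal_powr (f n + g n) r", OF le summableI summableI]
      by (simp add: sums flip: suminf_add[OF summableI summableI])
    also have "\<dots> = ennreal ((A + B) powr r * (C * A powr r + D * B powr r))"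
      using CD by (simp add: ennreal_mult)
    also have "C * A powr r + D * B powr r = 1"
    proof -
      have "C * A powr r + D * B powr r = A / (A + B) + B / (A + B)"
        using 3 by (simp add: C_def D_def)
      also have "\<dots> = 1" using 3 by (subst add_divide_distrib [symmetric]) simp
      finally show ?thesis .
    qed
    finally have "(\<Sum>n. ennreal_powr (f n + g n) r) \<le> ennreal_powr (ennreal A + ennreal B) r"
      using 3 by (simp add: ennreal_powr_ennreal flip: ennreal_plus)
    then show ?thesis
      using r(2) 3 ennreal_powr_le_iff[of "1 / r"] unfolding norm[of "\<lambda>n. f n + g n"] by simp
  qed
qed

section \<open>The weights and their \<open>l^q\<close> norms\<close>

lemma summable_log_powr:
  fixes s \<beta> :: real
  assumes "s < -1 \<or> s = -1 \<and> \<beta> < -1"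
  shows "summable (\<lambda>n. real n powr s * (1 + ln (real n)) powr \<beta>)"
  using assms
proof
  assume s: "s < -1"
  \<comment> \<open>Half of the gap between \<open>s\<close> and -1: one \<delta> absorbs the
    logarithmic factor, the other keeps the series convergent.\<close>
  define \<delta> where "\<delta> = - (s + 1) / 2"
  have \<delta>: "\<delta> > 0" "s = -1 - 2 * \<delta>" using s by (auto simp: \<delta>_def field_simps)
  have "(\<lambda>n. real n powr s * (1 + ln (real n)) powr \<beta>) \<in> O(\<lambda>n. real n powr (-1 - \<delta>))"
    unfolding \<delta>(2) using \<delta>(1) by real_asymp
  moreover have "summable (\<lambda>n. norm (real n powr (-1 - \<delta>)))"
    using \<delta>(1) by (simp add: summable_real_powr_iff)
  ultimately show ?thesis
    by (rule summable_comparison_test_bigo[rotated])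
next
  assume s: "s = -1 \<and> \<beta> < -1"
  define f where "f n = real n powr s * (1 + ln (real n)) powr \<beta>" for n
  \<comment> \<open>Cauchy condensation: at \<open>2 ^ n\<close> the factor \<open>2 ^ n\<close>
    cancels the power with exponent -1, and the logarithm becomes linear in \<open>n\<close>, which
    leaves a series of powers with exponent \<beta>.\<close>
  have "summable f \<longleftrightarrow> summable (\<lambda>n. 2 ^ n * f (2 ^ n))"
  proof (rule condensation_test)
    fix m :: nat assume "0 < m"
    then show "f (Suc m) \<le> f m"
      unfolding f_def using s by (intro mult_mono powr_mono2') (auto intro: add_pos_nonneg)
  qed (simp add: f_def)
  also have "(\<lambda>n. 2 ^ n * f (2 ^ n)) = (\<lambda>n. (1 + real n * ln 2) powr \<beta>)"
    using s by (simp add: f_def fun_eq_iff powr_minus ln_realpow)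
  also have "summable \<dots>"
  proof (rule summable_comparison_test_bigo)
    show "summable (\<lambda>n. norm (real n powr \<beta>))"
      using s by (simp add: summable_real_powr_iff)
    show "(\<lambda>n. (1 + real n * ln 2) powr \<beta>) \<in> O(\<lambda>n. real n powr \<beta>)"
      by real_asymp
  qed
  finally show ?thesis by (simp add: f_def)
qed

lemma bounded_log_powr:
  fixes s \<beta> :: real
  assumes "s < 0 \<or> s = 0 \<and> \<beta> < 0"
  shows "Bseq (\<lambda>n. real n powr s * (1 + ln (real n)) powr \<beta>)"
  using assms
proof
  assume "s < 0"
  then have "(\<lambda>n. real n powr s * (1 + ln (real n)) powr \<beta>) \<longlonglongrightarrow> 0" by real_asymp
  then show ?thesis by (rule convergent_imp_Bseq[OF convergentI])
next
  assume s: "s = 0 \<and> \<beta> < 0"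
  have "(\<lambda>n. real n powr 0 * (1 + ln (real n)) powr \<beta>) \<longlonglongrightarrow> 0"
    using conjunct2[OF s] by real_asymp
  then have "(\<lambda>n. real n powr s * (1 + ln (real n)) powr \<beta>) \<longlonglongrightarrow> 0"
    using s by simp
  then show ?thesis by (rule convergent_imp_Bseq[OF convergentI])
qed

text \<open>The additional -1 in the exponent is the averaging factor of the maximal sequence, so
  that the other factor in \<open>lz_norm_eq\<close> is a bare partial sum.\<close>

definition lz_weight :: "ennreal \<Rightarrow> ennreal \<Rightarrow> real \<Rightarrow> nat \<Rightarrow> real" where
  "lz_weight p q \<alpha> n = real (Suc n) powr (enn2real (1 / p) - 1 - enn2real (1 / q))
    * (1 + ln (real (Suc n))) powr \<alpha>"

lemma lz_weight_pos: "0 < lz_weight p q \<alpha> n"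
proof -
  have "0 < 1 + ln (real (Suc n))" by (simp add: add_pos_nonneg)
  then show ?thesis by (simp add: lz_weight_def del: of_nat_Suc)
qed

lemma lz_norm_eq:
  "lz_norm p q \<alpha> a =
    ell_norm q (\<lambda>n. topsum (\<lambda>k. e2ennreal \<bar>a k\<bar>) (Suc n) * ennreal (lz_weight p q \<alpha> n))"
proof -
  have "e2ennreal \<bar>maximal_seq a n * ereal (real (Suc n) powr (enn2real (1 / p) - enn2real (1 / q))
        * (1 + ln (real (Suc n))) powr \<alpha>)\<bar>
      = topsum (\<lambda>k. e2ennreal \<bar>a k\<bar>) (Suc n) * ennreal (lz_weight p q \<alpha> n)"
    (is "e2ennreal \<bar>_ * ereal ?c\<bar> = ?T * _") for n
  proof -
    have ln: "0 < 1 + ln (real (Suc n))" by (simp add: add_pos_nonneg)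
    then have c: "0 < ?c" by (simp del: of_nat_Suc)
    have w: "lz_weight p q \<alpha> n = ?c / real (Suc n)"
      using ln by (simp add: lz_weight_def powr_diff powr_add field_simps del: of_nat_Suc)
    have "(\<Sum>k\<le>n. rearr a k) = (\<Sum>k\<le>n. enn2ereal (e2ennreal (rearr a k)))"
      by (simp add: enn2ereal_e2ennreal rearr_nonneg)
    also have "\<dots> = enn2ereal ?T"
      by (simp add: lessThan_Suc_atMost flip: sum_rearr_eq_topsum)
    finally have "maximal_seq a n = enn2ereal ?T / ereal (real (Suc n))"
      by (simp add: maximal_seq_def)
    moreover have "e2ennreal \<bar>enn2ereal ?T / ereal (real (Suc n)) * ereal ?c\<bar>
        = ?T * ennreal (lz_weight p q \<alpha> n)"
    proof (cases ?T)
      case (real t)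
      then have "e2ennreal \<bar>enn2ereal ?T / ereal (real (Suc n)) * ereal ?c\<bar>
          = ennreal (t / real (Suc n) * ?c)"
        using c by (simp add: abs_mult del: of_nat_Suc)
      then show ?thesis
        using real c by (simp add: w flip: ennreal_mult del: of_nat_Suc)
    next
      case top
      have "enn2ereal ?T / ereal (real (Suc n)) * ereal ?c = \<infinity>"
        using c ln by (simp add: top del: of_nat_Suc)
      \<comment> \<open>Since 0 times infinity is 0, a vanishing weight would destroy the infinite
        partial sum.\<close>
      moreover have "ennreal (lz_weight p q \<alpha> n) \<noteq> 0"
        using lz_weight_pos[of p q \<alpha> n] by (simp add: ennreal_eq_0_iff)
      ultimately show ?thesis by (simp add: top ennreal_top_mult)
    qed
    ultimately show ?thesis by simp
  qed
  then show ?thesis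
    unfolding lz_norm_def lq_norm_def ell_norm_def by (simp only:)
qed

text \<open>With \<open>s = 1/p - 1\<close>, the hypothesis says that \<open>s < 0\<close>, or that
  \<open>s = 0\<close> and \<alpha> is below \<open>-1/q\<close>. For finite \<open>q = r\<close>
  the \<open>r\<close>-th power of the weight has the exponents \<open>s * r - 1\<close> and
  \<open>\<alpha> * r\<close>, which lie exactly in the range of \<open>summable_log_powr\<close>;
  for infinite \<open>q\<close> boundedness suffices.\<close>

lemma ell_norm_lz_weight_finite:
  assumes "(1 < p \<and> 1 \<le> q) \<or> (p = 1 \<and> 1 \<le> q \<and> \<alpha> < - enn2real (1 / q))"
  shows "ell_norm q (\<lambda>n. ennreal (lz_weight p q \<alpha> n)) < \<infinity>"
proof -
  define s where "s = enn2real (1 / p) - 1"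
  have "enn2real (1 / p) < 1" if "1 < p"
  proof (cases p)
    case (real t)
    then have "1 < t" using that by simp
    then show ?thesis using divide_ennreal[of 1 t] by (simp add: real)
  qed simp
  then have s: "s < 0 \<or> s = 0 \<and> \<alpha> < - enn2real (1 / q)"
    using assms by (auto simp: s_def)
  have w: "lz_weight p q \<alpha> n = real (Suc n) powr (s - enn2real (1 / q))
      * (1 + ln (real (Suc n))) powr \<alpha>" for n
    by (simp add: lz_weight_def s_def algebra_simps)
  have "1 \<le> q" using assms by auto
  then show ?thesis
  proof (cases rule: ennreal_ge_1_cases)
    case 1
    have "Bseq (\<lambda>n. real n powr s * (1 + ln (real n)) powr \<alpha>)"
      using s 1 by (intro bounded_log_powr) simp
    then obtain K where K: "\<And>n. real n powr s * (1 + ln (real n)) powr \<alpha> \<le> K"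
      unfolding Bseq_def by (metis abs_le_D1 real_norm_def)
    have "lz_weight p q \<alpha> n \<le> K" for n
      unfolding w unfolding 1 using K[of "Suc n"] by simp
    then have "ell_norm q (\<lambda>n. ennreal (lz_weight p q \<alpha> n)) \<le> ennreal K"
      using 1 by (auto simp: ell_norm_def intro!: SUP_least ennreal_leI)
    then show ?thesis using le_less_trans by fastforce
  next
    case 2
    define r where "r = enn2real q"
    have r: "1 \<le> r" "enn2real (1 / q) = 1 / r"
      using 2 by (cases q; auto simp: r_def divide_ennreal ennreal_1[symmetric] simp del: ennreal_1)+
    have "s * r - 1 < -1 \<or> s * r - 1 = -1 \<and> \<alpha> * r < -1"
      using s r mult_neg_pos[of s r] by (auto simp: field_simps)
    then have "summable (\<lambda>n. real n powr (s * r - 1) * (1 + ln (real n)) powr (\<alpha> * r))"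
      by (rule summable_log_powr)
    then have "summable (\<lambda>n. real (Suc n) powr (s * r - 1) * (1 + ln (real (Suc n))) powr (\<alpha> * r))"
      by (subst summable_Suc_iff)
    moreover have "lz_weight p q \<alpha> n powr r
        = real (Suc n) powr (s * r - 1) * (1 + ln (real (Suc n))) powr (\<alpha> * r)" for n
      using r by (simp add: w powr_mult powr_powr left_diff_distrib del: of_nat_Suc)
    ultimately have "summable (\<lambda>n. lz_weight p q \<alpha> n powr r)" by simp
    then have "(\<Sum>n. ennreal (lz_weight p q \<alpha> n powr r)) < \<infinity>"
      by (simp add: ennreal_suminf_neq_top less_top[symmetric])
    then show ?thesis
      using 2 by (simp only: ell_norm_def ennreal_powr_less_top_iff if_False r_def
          ennreal_powr_ennreal[OF less_imp_le[OF lz_weight_pos]])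
  qed
qed

section \<open>Verification of the axioms\<close>

theorem proposition5p5:
  fixes p q :: ennreal and \<alpha> :: real
  assumes "(1 < p \<and> 1 \<le> q) \<or> (p = 1 \<and> 1 \<le> q \<and> \<alpha> < - enn2real (1 / q))"
  shows "ri_banach_sequence_space (lz_space p q \<alpha>) (lz_norm p q \<alpha>)"
proof -
  have q: "1 \<le> q" using assms by auto
  let ?w = "\<lambda>n. ennreal (lz_weight p q \<alpha> n)"
  let ?T = "\<lambda>a n. topsum (\<lambda>k. e2ennreal \<bar>a k\<bar>) (Suc n)"
  have le_norm: "?T a n * ?w n \<le> lz_norm p q \<alpha> a" for a n
    unfolding lz_norm_eq by (rule le_ell_norm[OF q])
  have mono: "lz_norm p q \<alpha> a \<le> lz_norm p q \<alpha> b" if "\<And>n. \<bar>a n\<bar> \<le> \<bar>b n\<bar>" for a b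
    unfolding lz_norm_eq using that
    by (intro ell_norm_mono[OF q] mult_right_mono topsum_mono e2ennreal_mono) auto
  \<comment> \<open>Because of the index shift in \<open>?T\<close>, its term at
    \<open>card E\<close> admits sets of up to \<open>card E + 1\<close> elements, so
    \<open>E\<close> is covered even when empty. Dividing by the positive weight gives the constant
    in (P5); singletons give definiteness in (P1).\<close>
  have sum_le: "(\<Sum>k\<in>E. e2ennreal \<bar>a k\<bar>) \<le> ennreal (1 / lz_weight p q \<alpha> (card E)) * lz_norm p q \<alpha> a"
    if "finite E" for a :: "nat \<Rightarrow> ereal" and E
  proof -
    let ?v = "lz_weight p q \<alpha> (card E)"
    have "(\<Sum>k\<in>E. e2ennreal \<bar>a k\<bar>) = ennreal (1 / ?v) * ((\<Sum>k\<in>E. e2ennreal \<bar>a k\<bar>) * ennreal ?v)"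
      using lz_weight_pos[of p q \<alpha> "card E"]
      by (simp add: mult.left_commute[of "ennreal (1 / ?v)"] less_imp_le flip: ennreal_mult)
    also have "\<dots> \<le> ennreal (1 / ?v) * (?T a (card E) * ennreal ?v)"
      using that by (intro mult_left_mono mult_right_mono topsum_upper) auto
    also have "\<dots> \<le> ennreal (1 / ?v) * lz_norm p q \<alpha> a"
      by (intro mult_left_mono le_norm) simp
    finally show ?thesis .
  qed
  show ?thesis
  proof
    show "lz_space p q \<alpha> = {a. lz_norm p q \<alpha> a < \<infinity>}"
      by (simp add: lz_space_def)
  next
    fix a :: "nat \<Rightarrow> ereal"
    show "lz_norm p q \<alpha> a = 0 \<longleftrightarrow> (\<forall>n. a n = 0)"
    proof
      assume "lz_norm p q \<alpha> a = 0"
      then have "e2ennreal \<bar>a n\<bar> = 0" for n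
        using sum_le[of "{n}" a] by simp
      then have "\<bar>a n\<bar> = 0" for n
        by (metis abs_ereal_pos enn2ereal_e2ennreal zero_ennreal.rep_eq)
      then have "a n = 0" for n
        using \<open>\<And>n. \<bar>a n\<bar> = 0\<close>[of n] by (cases "a n") auto
      then show "\<forall>n. a n = 0" by simp
    next
      assume "\<forall>n. a n = 0"
      then have "?T a n = 0" for n
        using topsum_cmult[of 0 "\<lambda>k. 0"] by (simp add: e2ennreal_neg)
      then show "lz_norm p q \<alpha> a = 0"
        unfolding lz_norm_eq by (simp only: mult_zero_left ell_norm_0[OF q])
    qed
  next
    fix c :: real and a :: "nat \<Rightarrow> ereal"
    \<comment> \<open>For \<open>c = 0\<close> both sides vanish even at infinite \<open>x\<close>,
      as 0 times infinity is 0 in \<open>ereal\<close> and in \<open>ennreal\<close>.\<close>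
    have "e2ennreal \<bar>ereal c * x\<bar> = ennreal \<bar>c\<bar> * e2ennreal \<bar>x\<bar>" for x
      by (cases x; cases "c = 0")
        (auto simp: abs_mult ennreal_mult ennreal_mult_top ennreal_eq_0_iff e2ennreal_neg)
    then show "lz_norm p q \<alpha> (\<lambda>n. ereal c * a n) = ennreal \<bar>c\<bar> * lz_norm p q \<alpha> a"
      unfolding lz_norm_eq by (simp only: topsum_cmult mult.assoc ell_norm_cmult[OF q])
  next
    fix a b :: "nat \<Rightarrow> ereal"
    have "e2ennreal \<bar>x + y\<bar> \<le> e2ennreal \<bar>x\<bar> + e2ennreal \<bar>y\<bar>" for x y
      by (cases x; cases y) (auto simp: ennreal_leI simp flip: ennreal_plus)
    then have "?T (\<lambda>n. a n + b n) n \<le> ?T a n + ?T b n" for n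
      by (rule order_trans[OF topsum_mono topsum_add])
    then have "lz_norm p q \<alpha> (\<lambda>n. a n + b n) \<le> ell_norm q (\<lambda>n. ?T a n * ?w n + ?T b n * ?w n)"
      unfolding lz_norm_eq
      by (intro ell_norm_mono[OF q]) (simp add: mult_right_mono flip: distrib_right)
    also have "\<dots> \<le> lz_norm p q \<alpha> a + lz_norm p q \<alpha> b"
      unfolding lz_norm_eq by (rule ell_norm_add[OF q])
    finally show "lz_norm p q \<alpha> (\<lambda>n. a n + b n) \<le> lz_norm p q \<alpha> a + lz_norm p q \<alpha> b" .
  next
    fix a :: "nat \<Rightarrow> ereal"
    show "lz_norm p q \<alpha> (\<lambda>n. \<bar>a n\<bar>) = lz_norm p q \<alpha> a"
      by (simp add: lz_norm_eq)
  next
    fix a b :: "nat \<Rightarrow> ereal"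
    assume "\<And>n. 0 \<le> a n \<and> a n \<le> b n"
    then show "lz_norm p q \<alpha> a \<le> lz_norm p q \<alpha> b"
      by (intro mono) (metis abs_ereal_ge0 order_trans)
  next
    fix f :: "nat \<Rightarrow> nat \<Rightarrow> ereal" and a
    assume f: "\<And>k n. 0 \<le> f k n" "\<And>n. incseq (\<lambda>k. f k n)" "\<And>n. (\<lambda>k. f k n) \<longlonglongrightarrow> a n"
    \<comment> \<open>The limits are rewritten as increasing suprema, which pass in turn through
      \<open>topsum\<close>, the multiplication by the weight and \<open>ell_norm\<close>.\<close>
    have inc: "incseq (\<lambda>k. e2ennreal \<bar>f k n\<bar>)" for n
      using f(1,2) by (auto simp: incseq_def e2ennreal_mono)
    have "a n \<ge> 0" for n
      by (rule LIMSEQ_le_const[OF f(3)]) (use f(1) in auto)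
    then have "(\<lambda>k. e2ennreal \<bar>f k n\<bar>) \<longlonglongrightarrow> e2ennreal \<bar>a n\<bar>" for n
      using tendsto_e2ennrealI[OF f(3)] f(1) by simp
    then have "e2ennreal \<bar>a n\<bar> = (SUP k. e2ennreal \<bar>f k n\<bar>)" for n
      using LIMSEQ_unique LIMSEQ_SUP[OF inc] by blast
    then have "?T a n = (SUP k. ?T (f k) n)" for n
      by (simp only: topsum_SUP[OF inc])
    then have T: "?T a n * ?w n = (SUP k. ?T (f k) n * ?w n)" for n
      by (simp only: SUP_mult_right_ennreal)
    have "incseq (\<lambda>k. ?T (f k) n * ?w n)" for n
      using inc by (auto simp: incseq_def intro!: mult_right_mono topsum_mono)
    then have SUP: "lz_norm p q \<alpha> a = (SUP k. lz_norm p q \<alpha> (f k))"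
      unfolding lz_norm_eq T by (rule ell_norm_SUP[OF q])
    have "incseq (\<lambda>k. lz_norm p q \<alpha> (f k))"
      using f(1,2) by (auto simp: incseq_def intro!: mono)
    then show "incseq (\<lambda>k. lz_norm p q \<alpha> (f k)) \<and> (\<lambda>k. lz_norm p q \<alpha> (f k)) \<longlonglongrightarrow> lz_norm p q \<alpha> a"
      unfolding SUP using LIMSEQ_SUP by blast
  next
    fix E :: "nat set"
    assume E: "finite E"
    \<comment> \<open>The bound does not depend on \<open>n\<close>, so the norm is at most
      \<open>card E\<close> times the norm of the weight alone.\<close>
    have "?T (indicator E) n \<le> of_nat (card E)" for n
    proof (rule topsum_least)
      fix F :: "nat set" assume "finite F"
      have "(\<Sum>k\<in>F. e2ennreal \<bar>indicator E k\<bar>) = (\<Sum>k\<in>F. indicator E k)"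
        by (rule sum.cong) (auto simp: indicator_def e2ennreal_neg one_ereal_def)
      also have "\<dots> = of_nat (card (F \<inter> E))"
        using \<open>finite F\<close> by (simp add: indicator_def of_bool_def flip: sum.inter_restrict)
      also have "\<dots> \<le> of_nat (card E)"
        using E by (simp add: card_mono)
      finally show "(\<Sum>k\<in>F. e2ennreal \<bar>indicator E k\<bar>) \<le> of_nat (card E)" .
    qed
    then have "lz_norm p q \<alpha> (indicator E) \<le> ell_norm q (\<lambda>n. of_nat (card E) * ?w n)"
      unfolding lz_norm_eq by (intro ell_norm_mono[OF q] mult_right_mono) auto
    also have "\<dots> < \<infinity>"
      using ell_norm_lz_weight_finite[OF assms]
      by (simp add: ell_norm_cmult[OF q] ennreal_mult_less_top of_nat_less_top)
    finally show "lz_norm p q \<alpha> (indicator E) < \<infinity>" .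
  next
    fix E :: "nat set"
    assume "finite E"
    then show "\<exists>C :: real. \<forall>a\<in>lz_space p q \<alpha>.
        (\<Sum>n\<in>E. e2ennreal \<bar>a n\<bar>) \<le> ennreal C * lz_norm p q \<alpha> a"
      using sum_le by blast
  next
    fix a b :: "nat \<Rightarrow> ereal"
    assume "\<And>t. 0 \<le> t \<Longrightarrow> distr_fun a t = distr_fun b t"
    \<comment> \<open>The infimum in \<open>rearr\<close> involves only levels
      \<open>t \<ge> 0\<close>, where the distribution functions agree. Turning
      \<open>topsum\<close> back into sums of \<open>rearr\<close> then makes the two norms
      identical.\<close>
    then have "rearr a n = rearr b n" for n
      unfolding rearr_def by (metis (no_types, lifting))
    then show "lz_norm p q \<alpha> a = lz_norm p q \<alpha> b"
      by (simp add: lz_norm_eq flip: sum_rearr_eq_topsum)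
  qed
qed

end
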